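(* Let $f(x)=\frac{x^3+ax^2+bx+c}{dx+e}$ with $a,b,c,d,e\in\mathbb{C}_p$, $d\neq 0$, defined for $x\in\mathbb{C}_p$, $x\neq -\frac{e}{d}$, be a $(3,1)$-rational function with a unique fixed point. Then there exist $A,B\in\mathbb{C}_p$ with $AB\neq 0$ such that $f$ is topologically conjugate to the function $$g(x)=\frac{x^3+Ax^2+Bx}{Ax+B},\qquad x\in\mathbb{C}_p,\ x\neq -\frac{B}{A}.$$
   Context: $p$ is a prime and $\mathbb{C}_p$ is the field of complex $p$-adic numbers (the completion of an algebraic closure of $\mathbb{Q}_p$) with norm $|\cdot|_p$. The fixed point equation $f(x)=x$ is the cubic equation $x^3+(a-d)x^2+(b-e)x+c=0$. "$f$ has a unique fixed point" means that this cubic has a single root $x_0\in\mathbb{C}_p$ of multiplicity three, i.e. $x^3+(a-d)x^2+(b-e)x+c=(x-x_0)^3$, and that $x_0$ is a fixed point of $f$, so $x_0\neq -\frac{e}{d}$. Topologically conjugate means that there is a homeomorphism $h:\mathbb{C}_p\to\mathbb{C}_p$ mapping the domain of $g$ onto the domain of $f$ such that $h^{-1}\circ f\circ h=g$ on the domain of $g$. *)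

theory Defs
  imports "HOL-Analysis.Analysis" "HOL-Computational_Algebra.Computational_Algebra"
begin

text \<open>
  The class \<open>real_normed_field\<close> is Archimedean, so non-Archimedean valued fields get a class
  of their own; the metric (hence the topology) is the one induced by the absolute value. The
  constant \<open>norm\<close> cannot serve here because it is constrained to \<open>real_normed_vector\<close>.
\<close>

class nonarch_valued_field = field_char_0 + metric_space +
  fixes vnorm :: "'a \<Rightarrow> real"
  assumes dist_vnorm: "dist x y = vnorm (x - y)"
    and vnorm_mult: "vnorm (x * y) = vnorm x * vnorm y"
    and vnorm_ultrametric: "vnorm (x + y) \<le> max (vnorm x) (vnorm y)"

definition padic_abs :: "nat \<Rightarrow> rat \<Rightarrow> real" where
  "padic_abs p r =
     (if r = 0 then 0
      else real p powi (int (multiplicity (int p) (snd (quotient_of r)))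
                        - int (multiplicity (int p) (fst (quotient_of r)))))"

definition is_subfield :: "'a::field set \<Rightarrow> bool" where
  "is_subfield F \<longleftrightarrow> 1 \<in> F \<and> (\<forall>x\<in>F. \<forall>y\<in>F. x - y \<in> F \<and> x * y \<in> F) \<and> (\<forall>x\<in>F. inverse x \<in> F)"

definition is_algebraic_closure_of :: "'a::field set \<Rightarrow> 'a set \<Rightarrow> bool" where
  "is_algebraic_closure_of L F \<longleftrightarrow>
     is_subfield L \<and> F \<subseteq> L \<and>
     (\<forall>x\<in>L. \<exists>q. set (coeffs q) \<subseteq> F \<and> q \<noteq> 0 \<and> poly q x = 0) \<and>
     (\<forall>q. set (coeffs q) \<subseteq> L \<and> degree q > 0 \<longrightarrow> (\<exists>x\<in>L. poly q x = 0))"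

definition is_completion_of :: "'a::nonarch_valued_field set \<Rightarrow> 'a set \<Rightarrow> bool" where
  "is_completion_of E F \<longleftrightarrow> is_subfield E \<and> complete E \<and> F \<subseteq> E \<and> E \<subseteq> closure F"

definition is_padic_number_field :: "nat \<Rightarrow> 'a::nonarch_valued_field set \<Rightarrow> bool" where
  "is_padic_number_field p F \<longleftrightarrow>
     (\<forall>r. vnorm (of_rat r :: 'a) = padic_abs p r) \<and> is_completion_of F \<rat>"

text \<open>
  \<open>is_complex_padic_field p TYPE('a)\<close> says that \<open>'a\<close> is $\mathbb{C}_p$: its elements form the
  completion of an algebraic closure \<open>L\<close> of \<open>Q\<close>, where \<open>Q\<close> is the completion of the rationals
  with respect to the \<open>p\<close>-adic absolute value. This determines \<open>'a\<close> up to isometric field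
  isomorphism; all absolute values are restrictions of \<open>vnorm\<close> on \<open>'a\<close>.
\<close>

definition is_complex_padic_field :: "nat \<Rightarrow> 'a::nonarch_valued_field itself \<Rightarrow> bool" where
  "is_complex_padic_field p _ \<longleftrightarrow>
     (\<exists>Q L :: 'a set. is_padic_number_field p Q \<and> is_algebraic_closure_of L Q \<and>
        is_completion_of UNIV L)"

text \<open>
  The two maps are partial: only the values of \<open>f\<close> on \<open>D\<close> and of \<open>g\<close> on \<open>E\<close> matter.
\<close>

definition topologically_conjugate ::
    "('a::topological_space \<Rightarrow> 'a) \<Rightarrow> 'a set \<Rightarrow> ('a \<Rightarrow> 'a) \<Rightarrow> 'a set \<Rightarrow> bool" where
  "topologically_conjugate f D g E \<longleftrightarrow>
     (\<exists>h h'. homeomorphism UNIV UNIV h h' \<and> h ` E = D \<and> (\<forall>x\<in>E. h' (f (h x)) = g x))"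

text \<open>
  The polynomial below is the cubic whose roots outside the pole are the fixed points of
  \<open>\<lambda>x. (x ^ 3 + a * x\<^sup>2 + b * x + c) / (d * x + e)\<close>. Uniqueness of the fixed point is meant with
  multiplicity: the cubic is the cube of a linear factor.
\<close>

definition has_unique_fixed_point :: "'a::field \<Rightarrow> 'a \<Rightarrow> 'a \<Rightarrow> 'a \<Rightarrow> 'a \<Rightarrow> bool" where
  "has_unique_fixed_point a b c d e \<longleftrightarrow>
     (\<exists>x0. [:c, b - e, a - d, 1:] = [:- x0, 1:] ^ 3 \<and> x0 \<noteq> - (e / d))"

end

theory Submission
  imports Defs
begin

text \<open>Since the fixed point cubic is \<open>(x - x0)^3\<close>, the map has the form f(x) = x
  + (x - x0)^3 / (d x + e). Moving the fixed point to 0 by the translation h(x) = x + x0 turns it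
  into x + x^3 / (d x + B) with B = d x0 + e, which over a common denominator is g with A = d.
  Translations are isometries, hence homeomorphisms
  (\<open>homeomorphism_translation_nonarch\<close>); the rest is algebra, carried by
  \<open>cubic_eq_cube_imp_numerator\<close>.\<close>

lemma homeomorphism_translation_nonarch:
  fixes t :: "'a::nonarch_valued_field"
  shows "homeomorphism UNIV UNIV (\<lambda>x. x + t) (\<lambda>x. x - t)"
proof
  show "continuous_on UNIV (\<lambda>x::'a. x + t)" "continuous_on UNIV (\<lambda>x::'a. x - t)"
    unfolding continuous_on_iff dist_vnorm by auto
qed auto

text \<open>The fixed point cubic is the numerator minus \<open>y * (d * y + e)\<close>; evaluating
  the polynomial identity at \<open>y\<close> gives the claim. Dividing by \<open>d * y + e\<close>
  then splits f into the identity plus a remainder.\<close>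

lemma cubic_eq_cube_imp_numerator:
  fixes a b c d e x0 y :: "'a::comm_ring_1"
  assumes "[:c, b - e, a - d, 1:] = [:- x0, 1:] ^ 3"
  shows "y ^ 3 + a * y\<^sup>2 + b * y + c = (y - x0) ^ 3 + y * (d * y + e)"
proof -
  have "poly [:c, b - e, a - d, 1:] y = (y - x0) ^ 3"
    unfolding assms by (simp add: poly_power)
  then have "(y - x0) ^ 3 = c + y * (b - e + y * (a - d + y))"
    by simp
  then show ?thesis
    by (simp only:) (simp add: algebra_simps power2_eq_square power3_eq_cube)
qed

theorem proposition1:
  fixes p :: nat and a b c d e :: "'a::nonarch_valued_field"
  assumes "prime p"
    and "is_complex_padic_field p TYPE('a)"
    and "d \<noteq> 0"
    and "has_unique_fixed_point a b c d e"
  shows "\<exists>A B :: 'a. A * B \<noteq> 0 \<and>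
           topologically_conjugate
             (\<lambda>x. (x ^ 3 + a * x\<^sup>2 + b * x + c) / (d * x + e)) {x. x \<noteq> - (e / d)}
             (\<lambda>x. (x ^ 3 + A * x\<^sup>2 + B * x) / (A * x + B)) {x. x \<noteq> - (B / A)}"
proof -
  obtain x0 where cube: "[:c, b - e, a - d, 1:] = [:- x0, 1:] ^ 3" and x0: "x0 \<noteq> - (e / d)"
    using assms(4) unfolding has_unique_fixed_point_def by blast
  \<comment> \<open>The value of the denominator of f at the fixed point, nonzero because
    \<open>x0\<close> is not the pole.\<close>
  define B where "B = d * x0 + e"
  \<comment> \<open>Stated for arbitrary \<open>q\<close> so as to serve both domains, with
    \<open>q = e\<close> for f and \<open>q = B\<close> for g.\<close>
  have pole: "x = - (q / d) \<longleftrightarrow> d * x + q = 0" for x q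
    using \<open>d \<noteq> 0\<close> by (simp add: nonzero_eq_divide_eq eq_neg_iff_add_eq_0
        minus_divide_left mult.commute del: divide_minus_left)
  have "d * B \<noteq> 0"
    using x0 \<open>d \<noteq> 0\<close> by (simp add: B_def pole)
  moreover have "topologically_conjugate
             (\<lambda>x. (x ^ 3 + a * x\<^sup>2 + b * x + c) / (d * x + e)) {x. x \<noteq> - (e / d)}
             (\<lambda>x. (x ^ 3 + d * x\<^sup>2 + B * x) / (d * x + B)) {x. x \<noteq> - (B / d)}"
    unfolding topologically_conjugate_def
  proof (intro exI conjI ballI)
    show "homeomorphism UNIV UNIV (\<lambda>x. x + x0) (\<lambda>x. x - x0)"
      by (rule homeomorphism_translation_nonarch)
    have shift: "d * (x + x0) + e = d * x + B" for x
      by (simp add: B_def algebra_simps)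
    show "(\<lambda>x. x + x0) ` {x. x \<noteq> - (B / d)} = {x. x \<noteq> - (e / d)}"
    proof (intro equalityI subsetI)
      fix y assume "y \<in> {x. x \<noteq> - (e / d)}"
      then have "y - x0 \<in> {x. x \<noteq> - (B / d)}"
        using shift[of "y - x0"] by (simp add: pole)
      then show "y \<in> (\<lambda>x. x + x0) ` {x. x \<noteq> - (B / d)}"
        by (rule rev_image_eqI) simp
    qed (auto simp: pole shift)
    fix x assume "x \<in> {x. x \<noteq> - (B / d)}"
    then have nz: "d * x + B \<noteq> 0"
      by (simp add: pole)
    show "((x + x0) ^ 3 + a * (x + x0)\<^sup>2 + b * (x + x0) + c) / (d * (x + x0) + e) - x0
        = (x ^ 3 + d * x\<^sup>2 + B * x) / (d * x + B)"
      \<comment> \<open>At \<open>y = x + x0\<close> the quotient is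
        \<open>x ^ 3 / (d * x + B)\<close> plus \<open>x + x0\<close>; subtracting \<open>x0\<close>
        leaves g.\<close>
      unfolding cubic_eq_cube_imp_numerator[OF cube] shift
      using nz by (simp add: divide_simps) (simp add: algebra_simps power2_eq_square)
  qed
  ultimately show ?thesis
    by blast
qed

end
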